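(* Let $B(z),C(z)$ be analytic at $z=0$ with $B(0)=C(0)=1$, and let $B\diamond C(z)=B(\log C(z))$. Then for all $n\ge k\ge0$, \[ s_{B\diamond C}(n,k)=\sum_{j=k}^{n}s_C(n,j)s_B(j,k),\qquad S_{B\diamond C}(n,k)=\sum_{j=k}^{n}s_C(n,j)S_B(j,k). \] As a consequence, $S_C(n,k)=\sum_{j=k}^{n}s_C(n,j)S(j,k)$.
   Context: For $F$ analytic at $0$ with $F(0)=1$, $\log F(z)$ is the branch with $\log F(0)=0$ near $0$, and the $F$-Stirling numbers are defined by $\frac{(\log F(z))^k}{k!}=\sum_{n\ge k}s_F(n,k)\frac{z^n}{n!}$ and $\frac{(F(z)-1)^k}{k!}=\sum_{n\ge k}S_F(n,k)\frac{z^n}{n!}$. The $S(n,k)$ are the Stirling numbers of the second kind: $\frac{(e^z-1)^k}{k!}=\sum_{n\ge k}S(n,k)\frac{z^n}{n!}$. *)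

theory Defs
  imports "HOL-Complex_Analysis.Complex_Analysis" "HOL-Combinatorics.Stirling"
begin

text \<open>
  A function enters the following definitions only through its germ at \<open>0\<close>.  As \<open>F 0 = 1\<close> and
  the principal branch \<^const>\<open>Ln\<close> is analytic near \<open>1\<close> with \<open>Ln 1 = 0\<close>, near \<open>0\<close> the
  function \<open>\<lambda>z. Ln (F z)\<close> is the branch of \<open>log F\<close> that vanishes at \<open>0\<close>.
\<close>

definition F_stirling1 :: "(complex \<Rightarrow> complex) \<Rightarrow> nat \<Rightarrow> nat \<Rightarrow> complex" where
  "F_stirling1 F n k = fact n * fps_nth (fps_expansion (\<lambda>z. Ln (F z) ^ k / fact k) 0) n"

definition F_stirling2 :: "(complex \<Rightarrow> complex) \<Rightarrow> nat \<Rightarrow> nat \<Rightarrow> complex" where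
  "F_stirling2 F n k = fact n * fps_nth (fps_expansion (\<lambda>z. (F z - 1) ^ k / fact k) 0) n"

definition diamond :: "(complex \<Rightarrow> complex) \<Rightarrow> (complex \<Rightarrow> complex) \<Rightarrow> complex \<Rightarrow> complex"
    (infixl \<open>\<diamondop>\<close> 70) where
  "(B \<diamondop> C) z = B (Ln (C z))"


text \<open>
  The defining exponential generating functions; the coefficients with \<open>n < k\<close> vanish, so the
  series may be taken to start at \<open>n = k\<close>.
\<close>

lemma power_expansion_aux:
  fixes g :: "complex \<Rightarrow> complex"
  assumes "g analytic_on {0}" "g 0 = 0"
  defines "f \<equiv> (\<lambda>k z. g z ^ k / fact k)"
  shows "f k has_fps_expansion fps_expansion (f k) 0"
    and "n < k \<Longrightarrow> fps_nth (fps_expansion (f k) 0) n = 0"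
proof -
  define G where "G = fps_expansion g 0"
  have G: "g has_fps_expansion G"
    unfolding G_def using assms(1) by (rule analytic_at_imp_has_fps_expansion_0)
  have "(\<lambda>z. inverse (fact k) * g z ^ k) has_fps_expansion fps_const (inverse (fact k)) * G ^ k"
    by (intro fps_expansion_intros G)
  hence fk: "f k has_fps_expansion fps_const (inverse (fact k)) * G ^ k"
    by (simp add: f_def field_simps)
  hence eq: "fps_expansion (f k) 0 = fps_const (inverse (fact k)) * G ^ k"
    by (rule fps_expansion_eqI)
  show "f k has_fps_expansion fps_expansion (f k) 0"
    using fk eq by simp
  have "fps_nth G 0 = 0"
    using assms(2) by (simp add: G_def fps_expansion_def)
  thus "fps_nth (fps_expansion (f k) 0) n = 0" if "n < k"
    using that by (simp add: eq startsby_zero_power_prefix)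
qed

lemma F_stirling1_egf:
  assumes "F analytic_on {0}" "F 0 = 1"
  shows "(\<lambda>z. Ln (F z) ^ k / fact k) has_fps_expansion Abs_fps (\<lambda>n. F_stirling1 F n k / fact n)"
    and "n < k \<Longrightarrow> F_stirling1 F n k = 0"
proof -
  have an: "(\<lambda>z. Ln (F z)) analytic_on {0}"
    using assms by (intro analytic_intros) auto
  have z: "Ln (F 0) = 0"
    using assms(2) by simp
  have "Abs_fps (\<lambda>n. F_stirling1 F n k / fact n) = fps_expansion (\<lambda>z. Ln (F z) ^ k / fact k) 0"
    by (rule fps_ext) (simp add: F_stirling1_def)
  with power_expansion_aux(1)[OF an z, of k]
  show "(\<lambda>z. Ln (F z) ^ k / fact k) has_fps_expansion Abs_fps (\<lambda>n. F_stirling1 F n k / fact n)"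
    by simp
  show "F_stirling1 F n k = 0" if "n < k"
    using power_expansion_aux(2)[OF an z that] by (simp add: F_stirling1_def)
qed

lemma F_stirling2_egf:
  assumes "F analytic_on {0}" "F 0 = 1"
  shows "(\<lambda>z. (F z - 1) ^ k / fact k) has_fps_expansion Abs_fps (\<lambda>n. F_stirling2 F n k / fact n)"
    and "n < k \<Longrightarrow> F_stirling2 F n k = 0"
proof -
  have an: "(\<lambda>z. F z - 1) analytic_on {0}"
    using assms by (intro analytic_intros) auto
  have z: "F 0 - 1 = 0"
    using assms(2) by simp
  have "Abs_fps (\<lambda>n. F_stirling2 F n k / fact n) = fps_expansion (\<lambda>z. (F z - 1) ^ k / fact k) 0"
    by (rule fps_ext) (simp add: F_stirling2_def)
  with power_expansion_aux(1)[OF an z, of k]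
  show "(\<lambda>z. (F z - 1) ^ k / fact k) has_fps_expansion Abs_fps (\<lambda>n. F_stirling2 F n k / fact n)"
    by simp
  show "F_stirling2 F n k = 0" if "n < k"
    using power_expansion_aux(2)[OF an z that] by (simp add: F_stirling2_def)
qed


text \<open>
  The recursively defined \<^const>\<open>Stirling\<close> of the library has the generating function
  \<open>(exp z - 1) ^ k / k!\<close>.
\<close>

lemma Stirling_fps:
  "fps_nth (fps_const (inverse (fact k)) * (fps_exp 1 - 1 :: complex fps) ^ k) n =
     of_nat (Stirling n k) / fact n"
proof (induction n k rule: Stirling.induct)
  case (4 n k)
  let ?E = "\<lambda>k. fps_const (inverse (fact k)) * (fps_exp 1 - 1 :: complex fps) ^ k"
  have c: "fps_const (inverse (fact (Suc k))) * of_nat (Suc k) = fps_const (inverse (fact k) :: complex)"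
    by (simp add: fps_of_nat [symmetric] field_simps del: of_nat_Suc)
  have "fps_deriv (?E (Suc k)) =
          (fps_const (inverse (fact (Suc k))) * of_nat (Suc k)) * fps_exp 1 * (fps_exp 1 - 1) ^ k"
    by (simp add: fps_deriv_power fps_of_nat [symmetric] mult_ac del: of_nat_Suc fact_Suc power_Suc)
  also have "\<dots> = (fps_const (inverse (fact (Suc k))) * of_nat (Suc k)) *
                     (fps_exp 1 - 1) ^ Suc k + ?E k"
    unfolding c by (simp add: algebra_simps)
  also have "\<dots> = of_nat (Suc k) * ?E (Suc k) + ?E k"
    by (simp only: mult_ac)
  finally have "fps_nth (fps_deriv (?E (Suc k))) n = fps_nth (of_nat (Suc k) * ?E (Suc k) + ?E k) n"
    by simp
  hence "of_nat (Suc n) * fps_nth (?E (Suc k)) (Suc n) =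
           of_nat (Suc k) * fps_nth (?E (Suc k)) n + fps_nth (?E k) n"
    by (simp only: fps_of_nat [symmetric] fps_deriv_nth fps_add_nth fps_mult_left_const_nth Suc_eq_plus1)
  also have "\<dots> = of_nat (Stirling (Suc n) (Suc k)) / fact n"
    unfolding 4 by (simp add: field_simps)
  finally show ?case
    by (simp add: field_simps del: of_nat_Suc Stirling.simps power_Suc)
qed (simp_all add: fps_nth_power_0)

lemma Stirling_egf:
  "(\<lambda>z::complex. (exp z - 1) ^ k / fact k) has_fps_expansion
     Abs_fps (\<lambda>n. of_nat (Stirling n k) / fact n)"
proof -
  have "(\<lambda>z::complex. inverse (fact k) * (exp z - 1) ^ k) has_fps_expansion
          fps_const (inverse (fact k)) * (fps_exp 1 - 1) ^ k"
    by (intro fps_expansion_intros)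
  also have "fps_const (inverse (fact k)) * (fps_exp 1 - 1) ^ k =
               Abs_fps (\<lambda>n. of_nat (Stirling n k) / fact n :: complex)"
    by (rule fps_ext) (simp only: Stirling_fps fps_nth_Abs_fps)
  finally show ?thesis
    by (simp add: field_simps)
qed

end

theory Submission
  imports Defs
begin

text \<open>All three identities come from one substitution. Let \<open>h\<close> have the
  exponential coefficients \<open>a j\<close>. Putting \<open>w = Ln (C z)\<close> into
  \<open>h w = (\<Sum>j. a j * w ^ j / fact j)\<close> and expanding each
  \<open>Ln (C z) ^ j / fact j\<close>, whose exponential coefficients are the numbers
  \<open>F_stirling1 C n j\<close>, gives \<open>\<Sum>j. F_stirling1 C n j * a j\<close> as the
  coefficient of \<open>h (Ln (C z))\<close>. The choices of \<open>h w\<close> are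
  \<open>Ln (B w) ^ k / fact k\<close>, \<open>(B w - 1) ^ k / fact k\<close> and
  \<open>(exp w - 1) ^ k / fact k\<close>.\<close>

lemma fps_coeff_compose_Ln:
  fixes C h :: "complex \<Rightarrow> complex" and a :: "nat \<Rightarrow> complex"
  assumes C: "C analytic_on {0}" "C 0 = 1"
    and h: "h has_fps_expansion Abs_fps (\<lambda>j. a j / fact j)"
    and a: "\<And>j. j < k \<Longrightarrow> a j = 0"
    and g: "\<And>z. C z \<noteq> 0 \<Longrightarrow> g z = h (Ln (C z))"
  shows "fact n * fps_nth (fps_expansion g 0) n = (\<Sum>j=k..n. F_stirling1 C n j * a j)"
proof -
  define L where "L = fps_expansion (\<lambda>z. Ln (C z)) 0"
  have "(\<lambda>z. Ln (C z)) analytic_on {0}"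
    using C by (intro analytic_intros) auto
  hence L: "(\<lambda>z. Ln (C z)) has_fps_expansion L"
    unfolding L_def by (rule analytic_at_imp_has_fps_expansion_0)
  have L0: "fps_nth L 0 = 0"
    using C(2) by (simp add: L_def fps_expansion_def)
  have L_power: "fps_nth (L ^ j) n = fact j * F_stirling1 C n j / fact n" for j
  proof -
    have "(\<lambda>z. inverse (fact j) * Ln (C z) ^ j) has_fps_expansion
            fps_const (inverse (fact j)) * L ^ j"
      by (intro fps_expansion_intros L)
    hence "(\<lambda>z. Ln (C z) ^ j / fact j) has_fps_expansion fps_const (inverse (fact j)) * L ^ j"
      by (simp add: field_simps)
    hence "fps_expansion (\<lambda>z. Ln (C z) ^ j / fact j) 0 = fps_const (inverse (fact j)) * L ^ j"
      by (rule fps_expansion_eqI)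
    thus ?thesis
      by (simp add: F_stirling1_def field_simps)
  qed
  \<comment> \<open>The relation between \<open>g\<close> and \<open>h\<close> is only given where
    \<open>C\<close> is nonzero; continuity and \<open>C 0 = 1\<close> supply it on a neighbourhood
    of 0, which suffices for equal expansions.\<close>
  have "isCont C 0"
    using C(1) by (rule analytic_at_imp_isCont)
  hence "eventually (\<lambda>z. C z \<noteq> 0) (nhds 0)"
    using C(2) by (intro tendsto_imp_eventually_ne[of _ 1]) (simp_all add: isCont_def tendsto_nhds_iff)
  hence ev: "eventually (\<lambda>z. h (Ln (C z)) = g z) (nhds 0)"
    by eventually_elim (simp add: g)
  have "(h \<circ> (\<lambda>z. Ln (C z))) has_fps_expansion (Abs_fps (\<lambda>j. a j / fact j) oo L)"
    by (rule has_fps_expansion_compose[OF h L L0])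
  hence "g has_fps_expansion (Abs_fps (\<lambda>j. a j / fact j) oo L)"
    using has_fps_expansion_cong[OF ev refl] by (simp add: o_def)
  hence "fps_expansion g 0 = Abs_fps (\<lambda>j. a j / fact j) oo L"
    by (rule fps_expansion_eqI)
  \<comment> \<open>The sum stops at \<open>n\<close> because \<open>L\<close> has no constant term.
    In each summand the factor \<open>fact j\<close> from \<open>L_power\<close> cancels the
    denominator of \<open>a j / fact j\<close>, and \<open>fact n\<close> cancels likewise.\<close>
  hence "fact n * fps_nth (fps_expansion g 0) n = (\<Sum>j=0..n. F_stirling1 C n j * a j)"
    by (simp add: fps_compose_nth L_power sum_distrib_left mult_ac)
  also have "\<dots> = (\<Sum>j=k..n. F_stirling1 C n j * a j)"
    by (rule sum.mono_neutral_right) (auto simp: a)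
  finally show ?thesis .
qed

theorem theorem8:
  fixes B C :: "complex \<Rightarrow> complex"
  assumes "B analytic_on {0}" and "C analytic_on {0}"
    and "B 0 = 1" and "C 0 = 1"
  shows "(\<forall>n k. k \<le> n \<longrightarrow>
            F_stirling1 (B \<diamondop> C) n k = (\<Sum>j=k..n. F_stirling1 C n j * F_stirling1 B j k)) \<and>
         (\<forall>n k. k \<le> n \<longrightarrow>
            F_stirling2 (B \<diamondop> C) n k = (\<Sum>j=k..n. F_stirling1 C n j * F_stirling2 B j k)) \<and>
         (\<forall>n k. k \<le> n \<longrightarrow>
            F_stirling2 C n k = (\<Sum>j=k..n. F_stirling1 C n j * of_nat (Stirling j k)))"
proof (intro conjI allI impI)
  note B = assms(1,3) and C = assms(2,4)
  fix n k :: nat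
  show "F_stirling1 (B \<diamondop> C) n k = (\<Sum>j=k..n. F_stirling1 C n j * F_stirling1 B j k)"
    unfolding F_stirling1_def[of "B \<diamondop> C"]
    by (rule fps_coeff_compose_Ln[OF C F_stirling1_egf(1)[OF B]])
       (simp_all add: F_stirling1_egf(2)[OF B] diamond_def)
  show "F_stirling2 (B \<diamondop> C) n k = (\<Sum>j=k..n. F_stirling1 C n j * F_stirling2 B j k)"
    unfolding F_stirling2_def[of "B \<diamondop> C"]
    by (rule fps_coeff_compose_Ln[OF C F_stirling2_egf(1)[OF B]])
       (simp_all add: F_stirling2_egf(2)[OF B] diamond_def)
  \<comment> \<open>This is the case \<open>B = exp\<close>: where \<open>C z \<noteq> 0\<close>,
    \<open>exp (Ln (C z)) = C z\<close>, so \<open>exp \<diamondop> C\<close> has the same germ at 0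
    as \<open>C\<close>.\<close>
  show "F_stirling2 C n k = (\<Sum>j=k..n. F_stirling1 C n j * of_nat (Stirling j k))"
    unfolding F_stirling2_def
    by (rule fps_coeff_compose_Ln[OF C Stirling_egf]) simp_all
qed

end
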